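(* Let $K$ be a field and let $S$ be a $K$-algebra with a pseudo-degree function $\chi$. Let $a \in S$ be an element with $m = \chi(a) > 0$ such that the centralizer $C_S(a)$ satisfies condition $D(\ell)$ (with respect to $\chi$) for some positive integer $\ell$. Then $C_S(a)$ is a free $K[a]$-module of rank at most $\ell m$.
   Context: All rings and algebras are associative and unital. For a ring $S$ and $a \in S$, the centralizer $C_S(a)$ is the set of all elements of $S$ that commute with $a$. $K[a]$ denotes the subalgebra of $S$ consisting of all polynomials in $a$ with coefficients in $K$; it acts on $C_S(a)$ by multiplication. Pseudo-degree function: for a $K$-algebra $S$, a function $\chi : S \to \mathbb{Z} \cup \{-\infty\}$ is called a pseudo-degree function if (i) $\chi(a) = -\infty$ if and only if $a = 0$; (ii) $\chi(ab) = \chi(a) + \chi(b)$ for all $a,b \in S$; (iii) $\chi(a+b) \leq \max(\chi(a),\chi(b))$ for all $a,b \in S$. Condition $D(\ell)$: let $S$ be a $K$-algebra with pseudo-degree function $\chi$ and let $\ell$ be a positive integer. A subalgebra $B \subset S$ satisfies condition $D(\ell)$ if $\chi(b) \geq 0$ for all non-zero $b \in B$ and if, whenever $b_1, \ldots, b_{\ell+1} \in B$ are $\ell+1$ elements all mapped to the same integer by $\chi$ (in particular they are all non-zero), there exist $\alpha_1, \ldots, \alpha_{\ell+1} \in K$, not all zero, such that $\chi\left(\sum_{i=1}^{\ell+1} \alpha_i b_i\right) < \chi(b_1)$. *)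

theory Defs
  imports "HOL-Computational_Algebra.Polynomial" "HOL-Library.Extended"
begin

text \<open>
  A unital associative algebra over the field \<open>'k\<close>, with underlying ring the whole type \<open>'s\<close>.
  The ring need not be commutative.
\<close>

locale unital_algebra = vector_space scale
  for scale :: "'k::field \<Rightarrow> 's::ring_1 \<Rightarrow> 's" +
  assumes scale_mult_left: "scale r x * y = scale r (x * y)"
    and scale_mult_right: "x * scale r y = scale r (x * y)"

definition is_subalgebra :: "('k::field \<Rightarrow> 's::ring_1 \<Rightarrow> 's) \<Rightarrow> 's set \<Rightarrow> bool" where
  "is_subalgebra scale B \<longleftrightarrow>
     module.subspace scale B \<and> 1 \<in> B \<and> (\<forall>x\<in>B. \<forall>y\<in>B. x * y \<in> B)"

definition centralizer :: "'s::ring_1 \<Rightarrow> 's set" where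
  "centralizer a = {x. x * a = a * x}"

definition polys_in :: "('k::field \<Rightarrow> 's::ring_1 \<Rightarrow> 's) \<Rightarrow> 's \<Rightarrow> 's set" where
  "polys_in scale a = range (\<lambda>p :: 'k poly. \<Sum>i\<le>degree p. scale (coeff p i) (a ^ i))"

text \<open>
  The value set \<open>\<int> \<union> {-\<infinity>}\<close> is the type \<^typ>\<open>int extended\<close> with \<^const>\<open>Pinf\<close> excluded;
  on these values addition has the usual convention that \<^const>\<open>Minf\<close> is absorbing.
\<close>

definition pseudo_degree :: "('s::ring_1 \<Rightarrow> int extended) \<Rightarrow> bool" where
  "pseudo_degree \<chi> \<longleftrightarrow>
     (\<forall>a. \<chi> a \<noteq> Pinf) \<and>
     (\<forall>a. \<chi> a = Minf \<longleftrightarrow> a = 0) \<and>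
     (\<forall>a b. \<chi> (a * b) = \<chi> a + \<chi> b) \<and>
     (\<forall>a b. \<chi> (a + b) \<le> max (\<chi> a) (\<chi> b))"

text \<open>
  The elements \<open>b 1, \<dots>, b (l + 1)\<close> form a family and may repeat.
\<close>

definition condition_D ::
  "('k::field \<Rightarrow> 's::ring_1 \<Rightarrow> 's) \<Rightarrow> ('s \<Rightarrow> int extended) \<Rightarrow> nat \<Rightarrow> 's set \<Rightarrow> bool" where
  "condition_D scale \<chi> l B \<longleftrightarrow>
     is_subalgebra scale B \<and>
     (\<forall>b\<in>B. b \<noteq> 0 \<longrightarrow> \<chi> b \<ge> 0) \<and>
     (\<forall>(b :: nat \<Rightarrow> 's) (d :: int).
        (\<forall>i\<in>{1..l+1}. b i \<in> B \<and> \<chi> (b i) = Fin d) \<longrightarrow>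
        (\<exists>\<alpha> :: nat \<Rightarrow> 'k. (\<exists>i\<in>{1..l+1}. \<alpha> i \<noteq> 0) \<and>
            \<chi> (\<Sum>i=1..l+1. scale (\<alpha> i) (b i)) < \<chi> (b 1)))"

text \<open>
  Modules over a subring \<open>R\<close> of the ambient ring whose elements also lie in the ambient ring
  and on which \<open>R\<close> acts by multiplication from the left.
\<close>

definition is_subring :: "'s::ring_1 set \<Rightarrow> bool" where
  "is_subring R \<longleftrightarrow> 1 \<in> R \<and> (\<forall>x\<in>R. \<forall>y\<in>R. x - y \<in> R \<and> x * y \<in> R)"

definition mult_module :: "'s::ring_1 set \<Rightarrow> 's set \<Rightarrow> bool" where
  "mult_module R M \<longleftrightarrow>
     is_subring R \<and> 0 \<in> M \<and> (\<forall>x\<in>M. \<forall>y\<in>M. x - y \<in> M) \<and> (\<forall>r\<in>R. \<forall>x\<in>M. r * x \<in> M)"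

definition mult_module_basis :: "'s::ring_1 set \<Rightarrow> 's set \<Rightarrow> 's set \<Rightarrow> bool" where
  "mult_module_basis R M E \<longleftrightarrow>
     E \<subseteq> M \<and>
     (\<forall>x\<in>M. \<exists>F c. finite F \<and> F \<subseteq> E \<and> (\<forall>e\<in>F. c e \<in> R) \<and> x = (\<Sum>e\<in>F. c e * e)) \<and>
     (\<forall>F c. finite F \<longrightarrow> F \<subseteq> E \<longrightarrow> (\<forall>e\<in>F. c e \<in> R) \<longrightarrow> (\<Sum>e\<in>F. c e * e) = 0 \<longrightarrow>
        (\<forall>e\<in>F. c e = 0))"

text \<open>
  Over a nontrivial commutative ring \<open>R\<close> such as \<open>K[a]\<close>, all bases have the same cardinality,
  so the rank \<open>n\<close> is determined by \<open>R\<close> and \<open>M\<close>.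
\<close>

definition free_mult_module_of_rank :: "'s::ring_1 set \<Rightarrow> 's set \<Rightarrow> nat \<Rightarrow> bool" where
  "free_mult_module_of_rank R M n \<longleftrightarrow>
     mult_module R M \<and> (\<exists>E. mult_module_basis R M E \<and> finite E \<and> card E = n)"

lemma (in unital_algebra) centralizer_is_subalgebra: "is_subalgebra scale (centralizer a)"
  unfolding is_subalgebra_def subspace_def centralizer_def
  by (auto simp: algebra_simps scale_mult_left scale_mult_right) (metis mult.assoc)

end

theory Submission
  imports Defs
begin

text \<open>
  Call a finite set \<open>E\<close> of nonzero elements leading-independent if no nontrivial \<open>K\<close>-combination
  of elements \<open>a ^ k e * e\<close> of one common degree drops in degree. Comparing top degrees, such a set
  is linearly independent over \<open>K[a]\<close>. By condition \<open>D(l)\<close> it has at most \<open>l\<close> elements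
  in each residue class of degrees modulo \<open>m\<close>, as powers of \<open>a\<close> shift them to a common degree.
  Among the leading-independent sets whose \<open>K[a]\<close>-span contains every element of degree
  smaller than the degree of some member, take one of maximal size. It spans: otherwise
  adjoin an element of least degree outside the span.
\<close>

section \<open>Evaluation of polynomials at \<open>a\<close> and the ring
  \<open>K[a]\<close>\<close>

lemma (in unital_algebra) scale_eq_mult: "scale c x = scale c 1 * x"
  by (simp add: scale_mult_left)

context unital_algebra
begin

definition poly_at :: "'s \<Rightarrow> 'k poly \<Rightarrow> 's" where
  "poly_at a p = (\<Sum>i\<le>degree p. scale (coeff p i) (a ^ i))"

lemma polys_in_eq: "polys_in scale a = range (poly_at a)"
  by (simp add: polys_in_def poly_at_def)

text \<open>A summation bound independent of the polynomial lets evaluations of different degrees be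
  compared termwise.\<close>

lemma poly_at_altdef:
  assumes "degree p \<le> n"
  shows "poly_at a p = (\<Sum>i\<le>n. scale (coeff p i) (a ^ i))"
  unfolding poly_at_def
  by (rule sum.mono_neutral_left) (use assms in \<open>auto simp: coeff_eq_0\<close>)

lemma poly_at_0 [simp]: "poly_at a 0 = 0"
  by (simp add: poly_at_def)

lemma poly_at_diff: "poly_at a (p - q) = poly_at a p - poly_at a q"
proof -
  let ?n = "max (degree p) (degree q)"
  have "degree (p - q) \<le> ?n"
    by (rule degree_diff_le) auto
  then show ?thesis
    by (simp add: poly_at_altdef[of _ ?n] scale_left_diff_distrib sum_subtractf)
qed

lemma poly_at_add: "poly_at a (p + q) = poly_at a p + poly_at a q"
  using poly_at_diff[of a "p + q" q] by simp

lemma poly_at_smult: "poly_at a (smult c p) = scale c (poly_at a p)"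
  by (simp add: poly_at_altdef[of _ "degree p"] degree_smult_le scale_sum_right)

text \<open>Horner's rule, which drives the inductions for products and monomials.\<close>

lemma poly_at_pCons: "poly_at a (pCons c p) = scale c 1 + a * poly_at a p"
proof -
  \<comment> \<open>Only an inequality holds: for \<open>p = 0\<close> the left side is 0.\<close>
  have "degree (pCons c p) \<le> Suc (degree p)"
    by (rule degree_pCons_le)
  then show ?thesis
    by (simp add: poly_at_altdef[of _ "Suc (degree p)"] poly_at_def sum.atMost_Suc_shift
        sum_distrib_left scale_mult_right del: sum.atMost_Suc)
qed

lemma poly_at_mult: "poly_at a (p * q) = poly_at a p * poly_at a q"
proof (induction p)
  case (pCons c p)
  have "poly_at a (pCons c p * q) = scale c (poly_at a q) + a * poly_at a (p * q)"
    by (simp add: mult_pCons_left poly_at_add poly_at_smult poly_at_pCons)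
  then show ?case
    using pCons.IH by (simp add: poly_at_pCons distrib_right scale_mult_left mult.assoc)
qed simp

lemma poly_at_monom: "poly_at a (monom c n) = scale c (a ^ n)"
  by (induction n) (simp_all add: monom_0 monom_Suc poly_at_pCons scale_mult_right)

lemma scale_power_in_polys_in: "scale c (a ^ n) \<in> polys_in scale a"
  by (metis poly_at_monom polys_in_eq rangeI)

lemma polys_in_diff: "x \<in> polys_in scale a \<Longrightarrow> y \<in> polys_in scale a \<Longrightarrow> x - y \<in> polys_in scale a"
  by (auto simp: polys_in_eq simp flip: poly_at_diff)

lemma polys_in_scale: "x \<in> polys_in scale a \<Longrightarrow> scale c x \<in> polys_in scale a"
  by (auto simp: polys_in_eq simp flip: poly_at_smult)

lemma polys_in_0: "0 \<in> polys_in scale a"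
  by (metis poly_at_0 polys_in_eq rangeI)

lemma is_subring_polys_in: "is_subring (polys_in scale a)"
proof -
  have "1 \<in> polys_in scale a"
    using scale_power_in_polys_in[of 1 a 0] by simp
  moreover have "x * y \<in> polys_in scale a"
    if "x \<in> polys_in scale a" "y \<in> polys_in scale a" for x y
    using that by (auto simp: polys_in_eq simp flip: poly_at_mult)
  ultimately show ?thesis
    by (auto simp: is_subring_def polys_in_diff)
qed

section \<open>The centralizer as a module over \<open>K[a]\<close>\<close>

lemma centralizer_scale: "x \<in> centralizer a \<Longrightarrow> scale c x \<in> centralizer a"
  by (simp add: centralizer_def scale_mult_left scale_mult_right)

lemma centralizer_mult: "x \<in> centralizer (a :: 's) \<Longrightarrow> y \<in> centralizer a \<Longrightarrow> x * y \<in> centralizer a"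
  using centralizer_is_subalgebra[of a] by (simp add: is_subalgebra_def)

lemma centralizer_diff: "x \<in> centralizer (a :: 's) \<Longrightarrow> y \<in> centralizer a \<Longrightarrow> x - y \<in> centralizer a"
  by (simp add: centralizer_def algebra_simps)

lemma centralizer_sum: "(\<And>i. i \<in> I \<Longrightarrow> f i \<in> centralizer a) \<Longrightarrow> sum f I \<in> centralizer (a :: 's)"
  by (simp add: centralizer_def sum_distrib_left sum_distrib_right)

lemma power_in_centralizer: "a ^ n \<in> centralizer (a :: 's)"
  by (simp add: centralizer_def power_commutes)

lemma polys_in_subset_centralizer: "polys_in scale a \<subseteq> centralizer a"
  by (auto simp: polys_in_def intro!: centralizer_sum centralizer_scale power_in_centralizer)

lemma mult_module_centralizer: "mult_module (polys_in scale a) (centralizer a)"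
  unfolding mult_module_def
  using is_subring_polys_in polys_in_subset_centralizer
  by (auto simp: centralizer_def[of _, THEN eqset_imp_iff, of 0]
      intro: centralizer_diff centralizer_mult)

section \<open>Spans over \<open>K[a]\<close>\<close>

text \<open>For finite \<open>E\<close> this is the \<open>K[a]\<close>-span of \<open>E\<close>;
  members that do not occur get coefficient 0.\<close>

definition combinations :: "'s \<Rightarrow> 's set \<Rightarrow> 's set" where
  "combinations a E = {\<Sum>e\<in>E. c e * e | c. \<forall>e\<in>E. c e \<in> polys_in scale a}"

lemma combinations_diff:
  assumes "x \<in> combinations a E" "y \<in> combinations a E"
  shows "x - y \<in> combinations a E"
proof -
  obtain c d where "\<forall>e\<in>E. c e \<in> polys_in scale a" "\<forall>e\<in>E. d e \<in> polys_in scale a"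
      "x = (\<Sum>e\<in>E. c e * e)" "y = (\<Sum>e\<in>E. d e * e)"
    using assms by (auto simp: combinations_def)
  then show ?thesis
    unfolding combinations_def
    by (intro CollectI exI[of _ "\<lambda>e. c e - d e"])
      (simp add: polys_in_diff left_diff_distrib sum_subtractf)
qed

lemma combinations_scale:
  assumes "x \<in> combinations a E"
  shows "scale r x \<in> combinations a E"
proof -
  obtain c where "\<forall>e\<in>E. c e \<in> polys_in scale a" "x = (\<Sum>e\<in>E. c e * e)"
    using assms by (auto simp: combinations_def)
  then show ?thesis
    unfolding combinations_def
    by (intro CollectI exI[of _ "\<lambda>e. scale r (c e)"])
      (simp add: polys_in_scale scale_sum_right scale_mult_left)
qed

lemma combinations_mono:
  assumes "finite E'" "E \<subseteq> E'"
  shows "combinations a E \<subseteq> combinations a E'"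
proof
  fix x assume "x \<in> combinations a E"
  then obtain c where c: "\<forall>e\<in>E. c e \<in> polys_in scale a" "x = (\<Sum>e\<in>E. c e * e)"
    by (auto simp: combinations_def)
  have "x = (\<Sum>e\<in>E'. (if e \<in> E then c e else 0) * e)"
    unfolding c(2) by (rule sum.mono_neutral_cong_left) (use assms in auto)
  with c(1) show "x \<in> combinations a E'"
    unfolding combinations_def
    by (auto simp: polys_in_0 intro!: exI[of _ "\<lambda>e. if e \<in> E then c e else 0"])
qed

end

section \<open>Calculus of the pseudo-degree\<close>

locale pseudo_degree_centralizer = unital_algebra scale
  for scale :: "'k::field \<Rightarrow> 's::ring_1 \<Rightarrow> 's" +
  fixes \<chi> :: "'s \<Rightarrow> int extended" and a :: 's and m :: int and l :: nat
  assumes pseudo_degree: "pseudo_degree \<chi>"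
    and \<chi>_a: "\<chi> a = Fin m"
    and m_pos: "m > 0"
    and condition_D: "condition_D scale \<chi> l (centralizer a)"
begin

lemma \<chi>_mult: "\<chi> (x * y) = \<chi> x + \<chi> y"
  and \<chi>_add: "\<chi> (x + y) \<le> max (\<chi> x) (\<chi> y)"
  and \<chi>_eq_Minf_iff: "\<chi> x = Minf \<longleftrightarrow> x = 0"
  and \<chi>_neq_Pinf: "\<chi> x \<noteq> Pinf"
  using pseudo_degree by (auto simp: pseudo_degree_def)

lemma \<chi>_0 [simp]: "\<chi> 0 = Minf"
  by (simp add: \<chi>_eq_Minf_iff)

text \<open>The degree as an integer, meaningful only for \<open>x \<noteq> 0\<close>.\<close>

definition deg :: "'s \<Rightarrow> int" where
  "deg x = (THE d. \<chi> x = Fin d)"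

lemma \<chi>_eq_deg: "x \<noteq> 0 \<Longrightarrow> \<chi> x = Fin (deg x)"
  by (cases "\<chi> x") (auto simp: deg_def \<chi>_eq_Minf_iff \<chi>_neq_Pinf)

lemma \<chi>_one: "\<chi> 1 = Fin 0"
  using \<chi>_mult[of 1 1] \<chi>_eq_deg[of 1] by simp

lemma \<chi>_nonneg: "x \<in> centralizer a \<Longrightarrow> x \<noteq> 0 \<Longrightarrow> \<chi> x \<ge> Fin 0"
  using condition_D by (simp add: condition_D_def zero_extended_def)

text \<open>The scalars \<open>c\<close> and \<open>inverse c\<close> lie in the centralizer, so
  \<open>D(l)\<close> makes both degrees nonnegative. They add up to the degree of 1, which is 0,
  hence both vanish.\<close>

lemma \<chi>_scale:
  assumes "c \<noteq> 0"
  shows "\<chi> (scale c x) = \<chi> x"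
proof -
  have mem: "scale d 1 \<in> centralizer a" for d
    using power_in_centralizer[of a 0] by (simp add: centralizer_scale)
  have "scale c 1 * scale (inverse c) 1 = 1"
    using assms by (simp add: scale_mult_left)
  then have sum: "\<chi> (scale c 1) + \<chi> (scale (inverse c) 1) = Fin 0"
    by (metis \<chi>_mult \<chi>_one)
  have ne: "scale c 1 \<noteq> 0" "scale (inverse c) 1 \<noteq> 0"
    using assms by auto
  have "\<chi> (scale c 1) = Fin 0"
    using sum \<chi>_nonneg[OF mem ne(1)] \<chi>_nonneg[OF mem ne(2)] \<chi>_eq_deg[OF ne(1)] \<chi>_eq_deg[OF ne(2)]
    by simp
  then show ?thesis
    by (subst scale_eq_mult) (cases "\<chi> x"; simp add: \<chi>_mult)
qed

lemma \<chi>_minus: "\<chi> (- x) = \<chi> x"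
  using \<chi>_scale[of "-1" x] by simp

lemma \<chi>_add_less: "\<chi> x < Fin d \<Longrightarrow> \<chi> y < Fin d \<Longrightarrow> \<chi> (x + y) < Fin d"
  using \<chi>_add[of x y] by (metis max_less_iff_conj order_le_less_trans)

lemma \<chi>_sum_less:
  assumes "\<And>i. i \<in> I \<Longrightarrow> \<chi> (f i) < Fin d"
  shows "\<chi> (sum f I) < Fin d"
  using assms by (induction I rule: infinite_finite_induct) (auto intro: \<chi>_add_less)

lemma \<chi>_scale_less: "\<chi> x < Fin d \<Longrightarrow> \<chi> (scale c x) < Fin d"
  by (cases "c = 0") (auto simp: \<chi>_scale)

lemma \<chi>_power_mult: "x \<noteq> 0 \<Longrightarrow> \<chi> (a ^ k * x) = Fin (int k * m + deg x)"
  by (induction k) (simp_all add: \<chi>_eq_deg \<chi>_mult \<chi>_a mult.assoc algebra_simps)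

lemma \<chi>_power_mult_less:
  assumes "\<chi> (a ^ k * x) < Fin (int k * m + d)"
  shows "\<chi> x < Fin d"
  using assms \<chi>_eq_deg[of x] \<chi>_power_mult[of x k] by (cases "x = 0") auto

section \<open>Leading independence\<close>

text \<open>The leading terms of \<open>E\<close> are linearly independent over the polynomial
  action of \<open>a\<close> on the associated graded space. Only members with nonzero coefficient
  must be shifted to degree \<open>d\<close>, since the others need not have degree congruent to
  \<open>d\<close> modulo \<open>m\<close>.\<close>

definition leading_indep :: "'s set \<Rightarrow> bool" where
  "leading_indep E \<longleftrightarrow> finite E \<and> 0 \<notin> E \<and>
     (\<forall>\<alpha> k d. (\<forall>e\<in>E. \<alpha> e \<noteq> 0 \<longrightarrow> \<chi> (a ^ k e * e) = Fin d) \<longrightarrow>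
        \<chi> (\<Sum>e\<in>E. scale (\<alpha> e) (a ^ k e * e)) < Fin d \<longrightarrow> (\<forall>e\<in>E. \<alpha> e = 0))"

lemma leading_indepD:
  assumes "leading_indep E" "e \<in> E"
    and "\<And>e. e \<in> E \<Longrightarrow> \<alpha> e \<noteq> 0 \<Longrightarrow> \<chi> (a ^ k e * e) = Fin d"
    and "\<chi> (\<Sum>e\<in>E. scale (\<alpha> e) (a ^ k e * e)) < Fin d"
  shows "\<alpha> e = 0"
  using assms unfolding leading_indep_def by blast

lemma leading_indep_subset:
  assumes "leading_indep E" "F \<subseteq> E"
  shows "leading_indep F"
  unfolding leading_indep_def
proof (intro conjI allI impI ballI)
  have fin: "finite E" using assms by (simp add: leading_indep_def)
  show "finite F" "0 \<notin> F"
    using assms by (auto simp: leading_indep_def finite_subset)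
  fix \<alpha> :: "'s \<Rightarrow> 'k" and k d e
  assume h: "\<forall>e\<in>F. \<alpha> e \<noteq> 0 \<longrightarrow> \<chi> (a ^ k e * e) = Fin d"
    and less: "\<chi> (\<Sum>e\<in>F. scale (\<alpha> e) (a ^ k e * e)) < Fin d" and "e \<in> F"
  \<comment> \<open>Members outside \<open>F\<close> get coefficient 0, which exempts them from the
    degree requirement.\<close>
  let ?\<beta> = "\<lambda>e. if e \<in> F then \<alpha> e else 0"
  have "(\<Sum>e\<in>F. scale (\<alpha> e) (a ^ k e * e)) = (\<Sum>e\<in>E. scale (?\<beta> e) (a ^ k e * e))"
    by (rule sum.mono_neutral_cong_left) (use fin assms(2) in auto)
  then have "?\<beta> e = 0"
    by (intro leading_indepD[OF assms(1), where k = k and d = d])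
      (use \<open>e \<in> F\<close> assms(2) h less in \<open>auto split: if_splits\<close>)
  then show "\<alpha> e = 0" using \<open>e \<in> F\<close> by simp
qed

text \<open>In a vanishing combination, the terms of highest degree must cancel down to lower
  degree. Leading independence then kills leading coefficients that were chosen nonzero.\<close>

lemma leading_indep_imp_independent:
  assumes E: "leading_indep E"
    and c: "\<forall>e\<in>E. c e \<in> polys_in scale a"
    and zero: "(\<Sum>e\<in>E. c e * e) = 0"
  shows "\<forall>e\<in>E. c e = 0"
proof (rule ccontr)
  assume neg: "\<not> (\<forall>e\<in>E. c e = 0)"
  have nz: "e \<noteq> 0" if "e \<in> E" for e
    using E that by (auto simp: leading_indep_def)
  have fin: "finite E" using E by (simp add: leading_indep_def)
  have "\<forall>e\<in>E. \<exists>p. c e = poly_at a p"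
    using c by (auto simp: polys_in_eq)
  then obtain p where p: "\<And>e. e \<in> E \<Longrightarrow> c e = poly_at a (p e)" by metis
  \<comment> \<open>Since \<open>m > 0\<close>, this is the degree of the top term of
    \<open>c e * e\<close> when \<open>p e \<noteq> 0\<close>.\<close>
  define T where "T e = int (degree (p e)) * m + deg e" for e
  define N where "N = {e \<in> E. p e \<noteq> 0}"
  define d where "d = Max (T ` N)"
  have "N \<noteq> {}" "finite N" using neg p fin by (auto simp: N_def)
  then have "d \<in> T ` N" unfolding d_def by simp
  then obtain e0 where e0: "e0 \<in> N" "T e0 = d" by auto
  have T_le: "T e \<le> d" if "e \<in> N" for e
    using that \<open>finite N\<close> by (simp add: d_def)
  \<comment> \<open>The part of degree \<open>d\<close>: leading coefficients where the maximum is
    attained, 0 elsewhere.\<close>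
  define \<alpha> where "\<alpha> e = (if e \<in> N \<and> T e = d then lead_coeff (p e) else 0)" for e
  define k where "k e = degree (p e)" for e
  \<comment> \<open>What remains is below \<open>d\<close>: if \<open>T e = d\<close> the top term
    is removed and lower powers of \<open>a\<close> give smaller degrees; if \<open>T e < d\<close>
    all terms are already small.\<close>
  have rest: "\<chi> (c e * e - scale (\<alpha> e) (a ^ k e * e)) < Fin d" if e: "e \<in> E" for e
  proof (cases "e \<in> N")
    case False
    then show ?thesis using e p by (simp add: N_def \<alpha>_def)
  next
    case True
    have ce: "c e * e = (\<Sum>i\<le>k e. scale (coeff (p e) i) (a ^ i * e))"
      using p[OF e] by (simp add: poly_at_def k_def sum_distrib_right scale_mult_left)
    have term_less: "\<chi> (scale (coeff (p e) i) (a ^ i * e)) < Fin d"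
      if "int i * m + deg e < d" for i
      using that \<chi>_power_mult[OF nz[OF e], of i] by (intro \<chi>_scale_less) simp
    show ?thesis
    proof (cases "T e = d")
      case top: True
      have "c e * e - scale (\<alpha> e) (a ^ k e * e)
          = (\<Sum>i<k e. scale (coeff (p e) i) (a ^ i * e))"
        using True top by (simp add: ce \<alpha>_def k_def lessThan_Suc_atMost[symmetric])
      also have "\<chi> \<dots> < Fin d"
      proof (intro \<chi>_sum_less term_less)
        fix i assume "i \<in> {..<k e}"
        then have "int i * m < int (k e) * m" using m_pos by simp
        then show "int i * m + deg e < d" using top by (simp add: T_def k_def)
      qed
      finally show ?thesis .
    next
      case False
      have "\<chi> (c e * e) < Fin d"
        unfolding ce
      proof (intro \<chi>_sum_less term_less)
        fix i assume "i \<in> {..k e}"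
        then have "int i * m \<le> int (k e) * m" using m_pos by simp
        then show "int i * m + deg e < d"
          using False T_le[OF True] by (simp add: T_def k_def)
      qed
      then show ?thesis using False by (simp add: \<alpha>_def)
    qed
  qed
  \<comment> \<open>As the whole sum is 0, the part of degree \<open>d\<close> is minus the sum of
    the remainders, so it drops below \<open>d\<close>.\<close>
  have "(\<Sum>e\<in>E. c e * e - scale (\<alpha> e) (a ^ k e * e)) = - (\<Sum>e\<in>E. scale (\<alpha> e) (a ^ k e * e))"
    by (simp add: sum_subtractf zero)
  then have "\<chi> (\<Sum>e\<in>E. scale (\<alpha> e) (a ^ k e * e)) < Fin d"
    using \<chi>_sum_less[OF rest, of E "\<lambda>e. e"] by (simp add: \<chi>_minus)
  moreover have "\<chi> (a ^ k e * e) = Fin d" if "e \<in> E" "\<alpha> e \<noteq> 0" for e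
    using that nz by (auto simp: \<alpha>_def k_def T_def \<chi>_power_mult split: if_splits)
  moreover have "e0 \<in> E" using e0 by (simp add: N_def)
  ultimately have "\<alpha> e0 = 0"
    using leading_indepD[OF E] by blast
  then show False using e0 by (simp add: \<alpha>_def N_def)
qed

section \<open>Bounding the size by condition \<open>D(l)\<close>\<close>

lemma leading_dependence:
  assumes "\<And>i. i \<in> {1..l+1} \<Longrightarrow> b i \<in> centralizer a"
    and "\<And>i. i \<in> {1..l+1} \<Longrightarrow> \<chi> (b i) = Fin d"
  obtains \<alpha> i where "i \<in> {1..l+1}" "\<alpha> i \<noteq> 0"
    "\<chi> (\<Sum>i=1..l+1. scale (\<alpha> i) (b i)) < Fin d"
proof -
  have "(\<forall>i\<in>{1..l+1}. b i \<in> centralizer a \<and> \<chi> (b i) = Fin d) \<longrightarrow>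
      (\<exists>\<alpha>. (\<exists>i\<in>{1..l+1}. \<alpha> i \<noteq> 0) \<and>
        \<chi> (\<Sum>i=1..l+1. scale (\<alpha> i) (b i)) < \<chi> (b 1))"
    using condition_D unfolding condition_D_def by (elim conjE allE)
  then show ?thesis
    using assms assms(2)[of 1] that by auto
qed

text \<open>Degrees in one residue class differ by multiples of \<open>m\<close>, so
  \<open>l + 1\<close> members could be shifted to one degree, where \<open>D(l)\<close> yields a
  forbidden drop.\<close>

lemma card_same_residue_le:
  assumes E: "leading_indep E" "E \<subseteq> centralizer a"
    and res: "\<And>e. e \<in> E \<Longrightarrow> deg e mod m = r"
  shows "card E \<le> l"
proof (rule ccontr)
  assume "\<not> card E \<le> l"
  then obtain F where F: "F \<subseteq> E" "card F = l + 1" "finite F"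
    by (metis Suc_eq_plus1 not_less_eq_eq obtain_subset_with_card_n)
  have indep: "leading_indep F"
    using leading_indep_subset[OF E(1) F(1)] .
  then have nz: "e \<noteq> 0" if "e \<in> F" for e
    using that by (auto simp: leading_indep_def)
  \<comment> \<open>Taking the largest degree as target keeps all shift exponents
    nonnegative.\<close>
  define d where "d = Max (deg ` F)"
  have "F \<noteq> {}" using F by auto
  then have "d \<in> deg ` F" unfolding d_def using F(3) by simp
  then have d_res: "d mod m = r" using F(1) res by auto
  define k where "k e = nat ((d - deg e) div m)" for e
  have top: "\<chi> (a ^ k e * e) = Fin d" if "e \<in> F" for e
  proof -
    have "deg e \<le> d" using that F(3) by (simp add: d_def)
    moreover have "m dvd d - deg e"
      using that F(1) res d_res by (metis mod_eq_dvd_iff subsetD)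
    ultimately have "int (k e) * m = d - deg e"
      using m_pos by (simp add: k_def pos_imp_zdiv_nonneg_iff)
    then show ?thesis using \<chi>_power_mult[OF nz[OF that]] by simp
  qed
  \<comment> \<open>\<open>D(l)\<close> speaks of indexed families, so \<open>F\<close> is
    enumerated; injectivity of \<open>b\<close> allows the coefficients to be carried back to
    \<open>F\<close> through the inverse \<open>g\<close>.\<close>
  obtain b where b: "bij_betw b {1..l+1} F"
    using finite_same_card_bij[of "{1..l+1}" F] F by auto
  let ?b = "\<lambda>i. a ^ k (b i) * b i"
  have bF: "b i \<in> F" if "i \<in> {1..l+1}" for i
    using bij_betwE[OF b] that by blast
  obtain \<alpha> i0 where \<alpha>: "i0 \<in> {1..l+1}" "\<alpha> i0 \<noteq> 0"
    "\<chi> (\<Sum>i=1..l+1. scale (\<alpha> i) (?b i)) < Fin d"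
  proof (rule leading_dependence)
    show "?b i \<in> centralizer a" if "i \<in> {1..l+1}" for i
      using bF[OF that] E(2) F(1) by (auto intro: centralizer_mult power_in_centralizer)
    show "\<chi> (?b i) = Fin d" if "i \<in> {1..l+1}" for i
      using top bF[OF that] .
  qed
  define g where "g = the_inv_into {1..l+1} b"
  have g: "g (b i) = i" if "i \<in> {1..l+1}" for i
    using b that unfolding g_def bij_betw_def by (simp add: the_inv_into_f_f)
  have "(\<Sum>e\<in>F. scale (\<alpha> (g e)) (a ^ k e * e)) = (\<Sum>i=1..l+1. scale (\<alpha> (g (b i))) (?b i))"
    by (rule sum.reindex_bij_betw[OF b, symmetric])
  also have "\<dots> = (\<Sum>i=1..l+1. scale (\<alpha> i) (?b i))"
    by (rule sum.cong) (simp_all only: g)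
  also have "\<chi> \<dots> < Fin d"
    by (rule \<alpha>(3))
  finally have "\<alpha> (g (b i0)) = 0"
    using leading_indepD[OF indep bF[OF \<alpha>(1)], where \<alpha> = "\<lambda>e. \<alpha> (g e)" and k = k] top by blast
  then show False using g[OF \<alpha>(1)] \<alpha>(2) by simp
qed

lemma card_leading_indep_le:
  assumes E: "leading_indep E" "E \<subseteq> centralizer a"
  shows "card E \<le> l * nat m"
proof -
  let ?R = "\<lambda>r. {e \<in> E. deg e mod m = r}"
  have "card E = card (\<Union>r\<in>{0..<m}. ?R r)"
    using m_pos by (intro arg_cong[where f = card]) auto
  also have "\<dots> \<le> (\<Sum>r\<in>{0..<m}. card (?R r))"
    by (rule card_UN_le) simp
  also have "\<dots> \<le> (\<Sum>r\<in>{0..<m}. l)"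
    by (intro sum_mono card_same_residue_le leading_indep_subset[OF E(1)]) (use E(2) in auto)
  finally show ?thesis by (simp add: mult.commute)
qed

section \<open>Enlarging leading-independent sets\<close>

text \<open>In a dropping combination that involves \<open>x\<close>, the largest degree belongs to
  \<open>x\<close>, so its power of \<open>a\<close> is the smallest and can be cancelled. Dividing
  by the coefficient of \<open>x\<close> then gives a \<open>y\<close> in the span with
  \<open>x - y\<close> of smaller degree than \<open>x\<close>.\<close>

lemma leading_indep_insert:
  assumes E: "leading_indep E"
    and x: "x \<noteq> 0" "x \<notin> E"
    and le: "\<And>e. e \<in> E \<Longrightarrow> deg e \<le> deg x"
    and no_drop: "\<And>y. y \<in> combinations a E \<Longrightarrow> \<not> \<chi> (x - y) < \<chi> x"
  shows "leading_indep (insert x E)"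
  unfolding leading_indep_def
proof (intro conjI allI impI)
  have nz: "e \<noteq> 0" if "e \<in> E" for e
    using E that by (auto simp: leading_indep_def)
  have fin: "finite E" using E by (simp add: leading_indep_def)
  then show "finite (insert x E)" by simp
  show "0 \<notin> insert x E" using nz x(1) by auto
  fix \<alpha> :: "'s \<Rightarrow> 'k" and k d
  assume top: "\<forall>e\<in>insert x E. \<alpha> e \<noteq> 0 \<longrightarrow> \<chi> (a ^ k e * e) = Fin d"
    and less: "\<chi> (\<Sum>e\<in>insert x E. scale (\<alpha> e) (a ^ k e * e)) < Fin d"
  have "\<alpha> x = 0"
  proof (rule ccontr)
    assume \<alpha>x: "\<alpha> x \<noteq> 0"
    then have d: "d = int (k x) * m + deg x"
      using top \<chi>_power_mult[OF x(1), of "k x"] by simp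
    \<comment> \<open>Both shifted elements have degree \<open>d\<close> and
      \<open>deg e \<le> deg x\<close>, hence \<open>k x \<le> k e\<close>.\<close>
    have split: "a ^ k e = a ^ k x * a ^ (k e - k x)" if "e \<in> E" "\<alpha> e \<noteq> 0" for e
    proof -
      have "d = int (k e) * m + deg e"
        using top that \<chi>_power_mult[OF nz[OF that(1)], of "k e"] by simp
      then have "int (k x) * m \<le> int (k e) * m" using d le[OF that(1)] by linarith
      then show ?thesis using m_pos by (simp flip: power_add)
    qed
    \<comment> \<open>The subtraction \<open>k e - k x\<close> can truncate only where
      \<open>\<alpha> e = 0\<close>, and there the term vanishes.\<close>
    define z where "z = (\<Sum>e\<in>E. scale (\<alpha> e) (a ^ (k e - k x) * e))"
    have "(\<Sum>e\<in>E. scale (\<alpha> e) (a ^ k e * e)) = a ^ k x * z"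
      unfolding z_def sum_distrib_left
    proof (rule sum.cong)
      fix e assume "e \<in> E"
      then show "scale (\<alpha> e) (a ^ k e * e) = a ^ k x * scale (\<alpha> e) (a ^ (k e - k x) * e)"
        using split[of e] by (cases "\<alpha> e = 0") (simp_all add: scale_mult_right mult.assoc)
    qed simp
    then have "(\<Sum>e\<in>insert x E. scale (\<alpha> e) (a ^ k e * e)) = a ^ k x * (scale (\<alpha> x) x + z)"
      using fin x(2) by (simp add: distrib_left scale_mult_right)
    with less d have drop: "\<chi> (scale (\<alpha> x) x + z) < Fin (deg x)"
      using \<chi>_power_mult_less by metis
    have "z \<in> combinations a E"
      unfolding z_def combinations_def
      by (intro CollectI exI[of _ "\<lambda>e. scale (\<alpha> e) (a ^ (k e - k x))"])
        (simp add: scale_mult_left scale_power_in_polys_in)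
    then have mem: "scale (- inverse (\<alpha> x)) z \<in> combinations a E"
      by (rule combinations_scale)
    have "x - scale (- inverse (\<alpha> x)) z = scale (inverse (\<alpha> x)) (scale (\<alpha> x) x + z)"
      using \<alpha>x by (simp add: scale_right_distrib)
    then show False
      using no_drop[OF mem] \<chi>_scale_less[OF drop] \<chi>_eq_deg[OF x(1)] by simp
  qed
  moreover have "\<alpha> e = 0" if "e \<in> E" for e
    by (rule leading_indepD[OF E that, where k = k and d = d])
      (use top less \<open>\<alpha> x = 0\<close> fin x(2) in auto)
  ultimately show "\<forall>e\<in>insert x E. \<alpha> e = 0" by blast
qed

text \<open>The last clause forces any centralizer element outside the span to have at least the
  degree of every member, as \<open>leading_indep_insert\<close> requires. It is vacuous for the
  empty set.\<close>

definition saturated :: "'s set \<Rightarrow> bool" where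
  "saturated E \<longleftrightarrow> leading_indep E \<and> E \<subseteq> centralizer a \<and>
     (\<forall>x\<in>centralizer a. (\<exists>e\<in>E. \<chi> x < \<chi> e) \<longrightarrow> x \<in> combinations a E)"

lemma member_in_combinations:
  assumes "finite E" "e \<in> E"
  shows "e \<in> combinations a E"
proof -
  have "e \<in> combinations a {e}"
    using scale_power_in_polys_in[of 1 a 0] by (auto simp: combinations_def intro!: exI[of _ "\<lambda>_. 1"])
  then show ?thesis using combinations_mono[of E "{e}" a] assms by blast
qed

text \<open>Adjoin an \<open>x\<close> of least degree outside the span. Everything of smaller
  degree is then spanned, which both rules out a drop of \<open>x - y\<close> and keeps the enlarged
  set saturated.\<close>

lemma saturated_extend:
  assumes E: "saturated E" and "\<not> centralizer a \<subseteq> combinations a E"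
  shows "\<exists>x. x \<notin> E \<and> saturated (insert x E)"
proof -
  have indep: "leading_indep E" and sub: "E \<subseteq> centralizer a"
    and sat: "\<And>x e. x \<in> centralizer a \<Longrightarrow> e \<in> E \<Longrightarrow> \<chi> x < \<chi> e \<Longrightarrow> x \<in> combinations a E"
    using E by (auto simp: saturated_def)
  have fin: "finite E" and "0 \<notin> E" using indep by (auto simp: leading_indep_def)
  have zero: "0 \<in> combinations a E"
    using polys_in_0 by (auto simp: combinations_def intro!: exI[of _ "\<lambda>_. 0"])
  \<comment> \<open>Degrees of nonzero centralizer elements are nonnegative, so \<open>nat\<close>
    preserves their order and a least one exists.\<close>
  obtain x where x: "x \<in> centralizer a" "x \<notin> combinations a E"
    and min: "\<And>y. y \<in> centralizer a \<Longrightarrow> y \<notin> combinations a E \<Longrightarrow> nat (deg x) \<le> nat (deg y)"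
    using assms(2)
      ex_has_least_nat[of "\<lambda>x. x \<in> centralizer a \<and> x \<notin> combinations a E" _ "\<lambda>x. nat (deg x)"]
    by blast
  have nz: "x \<noteq> 0" using x zero by auto
  have less: "y \<in> combinations a E" if "y \<in> centralizer a" "\<chi> y < \<chi> x" for y
  proof (cases "y = 0")
    case False
    have "0 \<le> deg y" using \<chi>_nonneg[OF that(1) False] \<chi>_eq_deg[OF False] by simp
    moreover have "deg y < deg x" using that(2) \<chi>_eq_deg nz False by simp
    ultimately have "\<not> nat (deg x) \<le> nat (deg y)" by simp
    then show ?thesis using min that(1) by blast
  qed (use zero in simp)
  have "x \<notin> E" using x(2) member_in_combinations[OF fin] by blast
  \<comment> \<open>This keeps \<open>x - y\<close> in the centralizer, where the minimality of
    \<open>x\<close> applies.\<close>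
  have comb_sub: "combinations a E \<subseteq> centralizer a"
    using sub polys_in_subset_centralizer[of a]
    by (auto simp: combinations_def intro!: centralizer_sum centralizer_mult)
  have "leading_indep (insert x E)"
  proof (rule leading_indep_insert[OF indep nz \<open>x \<notin> E\<close>])
    fix e assume e: "e \<in> E"
    then have "\<not> \<chi> x < \<chi> e" "e \<noteq> 0" using sat x \<open>0 \<notin> E\<close> by auto
    then show "deg e \<le> deg x" using \<chi>_eq_deg nz by simp
  next
    fix y assume y: "y \<in> combinations a E"
    show "\<not> \<chi> (x - y) < \<chi> x"
    proof
      assume "\<chi> (x - y) < \<chi> x"
      then have "x - y \<in> combinations a E"
        using less[of "x - y"] x(1) y comb_sub by (auto intro: centralizer_diff)
      \<comment> \<open>This form needs only closure of the span under differences.\<close>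
      moreover have "x = (x - y) - (0 - y)" by simp
      ultimately have "x \<in> combinations a E"
        using combinations_diff y zero by metis
      then show False using x(2) by simp
    qed
  qed
  then have "saturated (insert x E)"
    using sub x(1) sat less combinations_mono[of "insert x E" E a] fin
    unfolding saturated_def by blast
  then show ?thesis using \<open>x \<notin> E\<close> by blast
qed

text \<open>Sizes of saturated sets are bounded by \<open>l * nat m\<close>, so a largest one
  exists; if it did not generate, \<open>saturated_extend\<close> would give a larger one.\<close>

lemma ex_saturated_generating:
  "\<exists>E. saturated E \<and> centralizer a \<subseteq> combinations a E"
proof -
  have "saturated {}" by (simp add: saturated_def leading_indep_def)
  moreover have "\<forall>E. saturated E \<longrightarrow> card E < Suc (l * nat m)"
    using card_leading_indep_le by (auto simp: saturated_def less_Suc_eq_le)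
  ultimately obtain E where E: "saturated E" and max: "\<And>E'. saturated E' \<Longrightarrow> card E' \<le> card E"
    using ex_has_greatest_nat[of saturated "{}" card] by blast
  have "finite E" using E by (simp add: saturated_def leading_indep_def)
  then have "centralizer a \<subseteq> combinations a E"
    using saturated_extend[OF E] max by fastforce
  with E show ?thesis by blast
qed

section \<open>The basis and its rank\<close>

lemma centralizer_free:
  "\<exists>n. free_mult_module_of_rank (polys_in scale a) (centralizer a) n \<and> int n \<le> int l * m"
proof -
  obtain E where E: "saturated E" and gen: "centralizer a \<subseteq> combinations a E"
    using ex_saturated_generating by blast
  have indep: "leading_indep E" and sub: "E \<subseteq> centralizer a"
    using E by (auto simp: saturated_def)
  have fin: "finite E" using indep by (simp add: leading_indep_def)
  have "mult_module_basis (polys_in scale a) (centralizer a) E"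
    unfolding mult_module_basis_def
  proof (intro conjI allI impI)
    show "\<forall>x\<in>centralizer a. \<exists>F c. finite F \<and> F \<subseteq> E \<and> (\<forall>e\<in>F. c e \<in> polys_in scale a) \<and>
        x = (\<Sum>e\<in>F. c e * e)"
      using gen fin unfolding combinations_def by blast
    \<comment> \<open>A relation may involve any subset of the basis, and leading independence
      passes to subsets.\<close>
    show "\<forall>e\<in>F. c e = 0" if "F \<subseteq> E" "\<forall>e\<in>F. c e \<in> polys_in scale a" "(\<Sum>e\<in>F. c e * e) = 0" for F c
      using leading_indep_imp_independent[OF leading_indep_subset[OF indep that(1)] that(2,3)] .
  qed (use sub in auto)
  then have "free_mult_module_of_rank (polys_in scale a) (centralizer a) (card E)"
    using mult_module_centralizer fin by (auto simp: free_mult_module_of_rank_def)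
  moreover have "int (card E) \<le> int l * m"
    using card_leading_indep_le[OF indep sub] m_pos
    by (metis int_nat_eq of_nat_le_iff of_nat_mult order_less_imp_le)
  ultimately show ?thesis by blast
qed

end

theorem theorem2p6:
  fixes scale :: "'k::field \<Rightarrow> 's::ring_1 \<Rightarrow> 's"
    and \<chi> :: "'s \<Rightarrow> int extended"
    and a :: 's and m :: int and l :: nat
  assumes "unital_algebra scale"
    and "pseudo_degree \<chi>"
    and "\<chi> a = Fin m" and "m > 0"
    and "l > 0"
    and "condition_D scale \<chi> l (centralizer a)"
  shows "\<exists>n. free_mult_module_of_rank (polys_in scale a) (centralizer a) n \<and> int n \<le> int l * m"
proof -
  interpret pseudo_degree_centralizer scale \<chi> a m l
    using assms by (simp add: pseudo_degree_centralizer_def pseudo_degree_centralizer_axioms_def)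
  show ?thesis by (rule centralizer_free)
qed

end
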